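(* Let $(I,\mathrm{d}i)$ be a measure space and let $\varphi:I\to[0,\infty]$ be a measurable function which takes values in $[0,1]$ and satisfies $\int_{i\in I}\varphi(i)\,\mathrm{d}i=1$. For $p\in[0,\infty]$, let the Rényi entropy of order $p$ be $$H_p(\varphi)=\frac{1}{1-p}\log\int_{i\in I}\varphi(i)^p\,\mathrm{d}i,$$ where for $p=0,1,\infty$ this expression is interpreted in the limit (notably, for $p=1$ it recovers Shannon entropy). Then $H_p(\varphi)$ is, up to the multiplicative constant $\frac{p}{1-p}$, the additive semantics of $p$-universally quantifying the negation of $-\log\varphi$: $$H_p(\varphi)=\left[\!\left[\tfrac{p}{1-p}\cdot\big(\forall^p(i\in I).\,-\log\varphi(i)^*\big)\right]\!\right]_{\oplus}.$$ Moreover, the purely multiplicative quantity $$D_p(\varphi)=\left[\!\left[\tfrac{p}{1-p}\cdot\big(\forall^p(i\in I).\,\varphi(i)^*\big)\right]\!\right]_{\otimes}$$ is the $p$-diversity ($p$-th Hill number) of $\varphi$.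
   Context: The logarithm is natural, extended by $\log 0=-\infty$, $\log\infty=\infty$, and the exponential is extended by $e^{-\infty}=0$, $e^{\infty}=\infty$. Integrals are Lebesgue integrals of $[0,\infty]$-valued functions. Multiplicative semantics $[\![-]\!]_\otimes$ takes values in measurable functions into $[0,\infty]$. A measurable function is interpreted as itself. Negation is the duality $a^*:=1/a$, with $0^*=\infty$, $\infty^*=0$. The scalar modality is $k\cdot a:=a^k$. The soft universal quantifier is $$[\![\forall^p(i\in I).\,a(i)]\!]_\otimes:=\Big(\int_{i\in I}a(i)^{-p}\,\mathrm{d}i\Big)^{-1/p}.$$ Additive semantics $[\![-]\!]_\oplus$ takes values in measurable functions into $[-\infty,\infty]$. A measurable function is interpreted as itself. Negation is $a^*:=-a$. The scalar modality is $k\cdot a:=ka$. The soft universal quantifier is $$[\![\forall^p(i\in I).\,u(i)]\!]_\oplus:=\frac1p\log\int_{i\in I}e^{p\,u(i)}\,\mathrm{d}i .$$ For the extreme values of $p$ the quantifiers, and the formulas above, are interpreted in the limit. In the formula for $H_p$, the expression $-\log\varphi(i)^*$ is the negation of $-\log\varphi(i)$, i.e. $\log\varphi(i)$; reading it as $-\log(\varphi(i)^* )$ gives the same function. The $p$-diversity (Hill number of order $p$) of $\varphi$ is, in the standard definition, $\big(\int_{i\in I}\varphi(i)^p\,\mathrm{d}i\big)^{1/(1-p)}=e^{H_p(\varphi)}$, again taken in the limit for $p=0,1,\infty$.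
   Formalization: The displayed D_p is the reciprocal of the Hill number (uniform on two points, p=2: 1/2 versus 2), so what is proved is that its negation D_p^* is the p-diversity; at p=1 the limit is taken from the right, since the two-sided limit may not exist. *)

theory Defs
  imports "HOL-Analysis.Analysis"
begin

definition elog :: "ennreal \<Rightarrow> ereal" where
  "elog a = (if a = 0 then -\<infinity> else if a = top then \<infinity> else ereal (ln (enn2real a)))"

definition eexp :: "ereal \<Rightarrow> ennreal" where
  "eexp u = (if u = -\<infinity> then 0 else if u = \<infinity> then top else ennreal (exp (real_of_ereal u)))"

definition epow :: "ennreal \<Rightarrow> real \<Rightarrow> ennreal" where
  "epow a k =
     (if k = 0 then 1
      else if a = 0 then (if k > 0 then 0 else top)
      else if a = top then (if k > 0 then top else 0)
      else ennreal (enn2real a powr k))"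

text \<open>Multiplicative semantics, with values in \<open>[0,\<infinity>]\<close>.\<close>

definition mul_neg :: "ennreal \<Rightarrow> ennreal" where
  "mul_neg a = 1 / a"

definition mul_scale :: "real \<Rightarrow> ennreal \<Rightarrow> ennreal" where
  "mul_scale k a = epow a k"

definition mul_forall :: "'i measure \<Rightarrow> real \<Rightarrow> ('i \<Rightarrow> ennreal) \<Rightarrow> ennreal" where
  "mul_forall M p a = epow (\<integral>\<^sup>+ i. epow (a i) (- p) \<partial>M) (- 1 / p)"

text \<open>Additive semantics, with values in \<open>[-\<infinity>,\<infinity>]\<close>.\<close>

definition add_neg :: "ereal \<Rightarrow> ereal" where
  "add_neg u = - u"

definition add_scale :: "real \<Rightarrow> ereal \<Rightarrow> ereal" where
  "add_scale k u = ereal k * u"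

definition add_forall :: "'i measure \<Rightarrow> real \<Rightarrow> ('i \<Rightarrow> ereal) \<Rightarrow> ereal" where
  "add_forall M p u = ereal (1 / p) * elog (\<integral>\<^sup>+ i. eexp (ereal p * u i) \<partial>M)"

text \<open>
  Extension to the orders \<open>0\<close>, \<open>1\<close>, \<open>\<infinity>\<close> by limits. A whole expression is extended, not its
  parts: at order \<open>1\<close> the scalar \<open>p / (1 - p)\<close> has no value of its own, and at order \<open>0\<close> the
  quantifier generally diverges while the scalar vanishes.

  At order \<open>1\<close> the limit is taken from the right. It is the two-sided limit whenever the latter
  exists, but the latter may fail to exist: for \<open>\<phi> n\<close> proportional to \<open>1 / (n (log n)\<^sup>3)\<close> the
  Shannon entropy is finite although the integral of \<open>\<phi>\<^sup>p\<close> is infinite for all \<open>p < 1\<close>. The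
  right limit is the Shannon entropy in all cases.
\<close>

definition order_filter :: "ennreal \<Rightarrow> real filter" where
  "order_filter p = (if p = top then at_top else at_right (enn2real p))"

definition limit_extension :: "(real \<Rightarrow> 'b::t2_space) \<Rightarrow> ennreal \<Rightarrow> 'b" where
  "limit_extension f p =
     (if p \<in> {0, 1, top} then Lim (order_filter p) f else f (enn2real p))"

definition renyi_expr :: "'i measure \<Rightarrow> ('i \<Rightarrow> ennreal) \<Rightarrow> real \<Rightarrow> ereal" where
  "renyi_expr M \<phi> p = ereal (1 / (1 - p)) * elog (\<integral>\<^sup>+ i. epow (\<phi> i) p \<partial>M)"

definition renyi_entropy :: "'i measure \<Rightarrow> ('i \<Rightarrow> ennreal) \<Rightarrow> ennreal \<Rightarrow> ereal" where
  "renyi_entropy M \<phi> = limit_extension (renyi_expr M \<phi>)"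

text \<open>For \<open>\<phi> \<le> 1\<close> the integrand is nonnegative, so nothing is lost by \<^const>\<open>e2ennreal\<close>; the
  convention \<open>0 * \<infinity> = 0\<close> takes care of the zeros of \<open>\<phi>\<close>.\<close>

definition shannon_entropy :: "'i measure \<Rightarrow> ('i \<Rightarrow> ennreal) \<Rightarrow> ereal" where
  "shannon_entropy M \<phi> = enn2ereal (\<integral>\<^sup>+ i. \<phi> i * e2ennreal (- elog (\<phi> i)) \<partial>M)"

definition hill_number :: "'i measure \<Rightarrow> ('i \<Rightarrow> ennreal) \<Rightarrow> ennreal \<Rightarrow> ennreal" where
  "hill_number M \<phi> = limit_extension (\<lambda>q. epow (\<integral>\<^sup>+ i. epow (\<phi> i) q \<partial>M) (1 / (1 - q)))"

definition additive_entropy :: "'i measure \<Rightarrow> ('i \<Rightarrow> ennreal) \<Rightarrow> ennreal \<Rightarrow> ereal" where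
  "additive_entropy M \<phi> = limit_extension
     (\<lambda>q. add_scale (q / (1 - q)) (add_forall M q (\<lambda>i. add_neg (- elog (\<phi> i)))))"

text \<open>
  The formula for \<open>D\<^sub>p(\<phi>)\<close>. The quantifiers of the two semantics correspond under \<open>u = - log a\<close>, so this formula
  has the value \<open>exp (- H\<^sub>p(\<phi>))\<close> and is the dual (reciprocal) of the Hill number
  \<open>exp (H\<^sub>p(\<phi>))\<close>: for the uniform distribution on two points it is \<open>1 / 2\<close>, while the Hill number
  is \<open>2\<close>. It is the Hill number only after applying \<^const>\<open>mul_neg\<close>.
\<close>

definition multiplicative_diversity :: "'i measure \<Rightarrow> ('i \<Rightarrow> ennreal) \<Rightarrow> ennreal \<Rightarrow> ennreal" where
  "multiplicative_diversity M \<phi> = limit_extension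
     (\<lambda>q. mul_scale (q / (1 - q)) (mul_forall M q (\<lambda>i. mul_neg (\<phi> i))))"

end

theory Submission
  imports Defs "HOL-Real_Asymp.Real_Asymp"
begin

text \<open>
  Under \<open>log\<close> and \<open>exp\<close> the scalar \<open>k\<close> acts by \<open>u \<mapsto> k u\<close> and by \<open>a \<mapsto> a\<^sup>k\<close>, also at the infinite
  values, so for each order \<open>q > 0\<close> the formulas agree by plain algebra. What remains is the
  convergence at the orders \<open>0\<close>, \<open>1\<close>, \<open>\<infinity>\<close>. By Jensen's inequality for the probability measure \<open>\<phi> di\<close>
  the Renyi entropy is decreasing in the order on \<open>(0, 1)\<close> and on \<open>(1, \<infinity>)\<close>, so all three one-sided
  limits exist. At order \<open>1\<close> the limit is at most the Shannon entropy, again by Jensen, and at least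
  the Shannon entropy by Fatou's lemma for the difference quotients of \<open>q \<mapsto> \<phi>\<^sup>q\<close>, as
  \<open>1 - P \<le> - log P\<close> for the integral \<open>P\<close> of \<open>\<phi>\<^sup>q\<close>.
\<close>

section \<open>Extended logarithm, exponential and powers\<close>

lemma elog_eexp [simp]: "elog (eexp u) = u"
  by (cases u) (auto simp: elog_def eexp_def)

lemma eexp_elog [simp]: "eexp (elog a) = a"
  by (cases a) (auto simp: elog_def eexp_def)

lemma eexp_mono: "u \<le> v \<Longrightarrow> eexp u \<le> eexp v"
  by (cases u; cases v) (auto simp: eexp_def intro: ennreal_leI)

lemma elog_le_iff: "elog a \<le> elog b \<longleftrightarrow> a \<le> b"
proof
  show "elog a \<le> elog b \<Longrightarrow> a \<le> b"
    using eexp_mono by fastforce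
next
  \<comment> \<open>As the order is total, \<open>elog\<close> inherits monotonicity from its
    inverse \<open>eexp\<close>.\<close>
  have "elog a \<le> elog b \<or> elog b \<le> elog a"
    by (rule linear)
  then show "a \<le> b \<Longrightarrow> elog a \<le> elog b"
    using eexp_mono[of "elog b" "elog a"] by auto
qed

lemma elog_ennreal: "0 < c \<Longrightarrow> elog (ennreal c) = ereal (ln c)"
  by (simp add: elog_def)

text \<open>In \<open>ereal\<close>, zero times an infinite value is 0; this matches
  \<open>epow a 0 = 1\<close> at \<open>a = 0\<close> and \<open>a = top\<close>.\<close>

lemma eexp_scale_elog: "eexp (ereal k * elog a) = epow a k"
  by (cases a; cases k "0::real" rule: linorder_cases)
     (auto simp: elog_def eexp_def epow_def powr_def)

lemma elog_epow: "elog (epow a k) = ereal k * elog a"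
  by (metis eexp_scale_elog elog_eexp)

lemma epow_epow: "epow (epow a j) k = epow a (j * k)"
  by (metis eexp_scale_elog elog_epow mult.assoc mult.commute times_ereal.simps(1))

text \<open>As a power, negation can be merged with the other exponents by
  \<open>epow_epow\<close>.\<close>

lemma mul_neg_eq_epow: "mul_neg a = epow a (-1)"
  by (cases a rule: ennreal_cases)
     (auto simp: mul_neg_def epow_def ennreal_top_divide powr_minus divide_ennreal_def inverse_ennreal)

lemma epow_ennreal: "0 \<le> x \<Longrightarrow> 0 < k \<Longrightarrow> epow (ennreal x) k = ennreal (x powr k)"
  by (auto simp: epow_def)

lemma tendsto_mul_neg: "(f \<longlongrightarrow> l) F \<Longrightarrow> ((\<lambda>x. mul_neg (f x)) \<longlongrightarrow> mul_neg l) F"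
  using continuous_on_tendsto_compose[OF continuous_on_inverse_ennreal[OF continuous_on_id], of f l F UNIV]
  by (simp add: mul_neg_def divide_ennreal_def)

section \<open>One-sided limits and the extension by limits\<close>

lemma antimono_on_tendsto_at_right_SUP:
  fixes h :: "real \<Rightarrow> 'a::{complete_linorder, linorder_topology}"
  assumes "antimono_on {a<..<b} h" "a < b"
  shows "(h \<longlongrightarrow> (SUP x\<in>{a<..<b}. h x)) (at_right a)"
proof (rule increasing_tendsto)
  show "\<forall>\<^sub>F x in at_right a. h x \<le> (SUP x\<in>{a<..<b}. h x)"
    using eventually_at_right_real[OF \<open>a < b\<close>] by eventually_elim (auto intro: SUP_upper)
next
  fix y assume "y < (SUP x\<in>{a<..<b}. h x)"
  then obtain c where c: "c \<in> {a<..<b}" "y < h c"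
    by (auto simp: less_SUP_iff)
  then have "\<forall>\<^sub>F x in at_right a. x \<in> {a<..<c}"
    by (intro eventually_at_right_real) auto
  then show "\<forall>\<^sub>F x in at_right a. y < h x"
    by eventually_elim (use c assms in \<open>auto simp: monotone_on_def intro: less_le_trans[of _ "h c"]\<close>)
qed

lemma antimono_on_tendsto_at_top_INF:
  fixes h :: "real \<Rightarrow> 'a::{complete_linorder, linorder_topology}"
  assumes "antimono_on {a<..} h"
  shows "(h \<longlongrightarrow> (INF x\<in>{a<..}. h x)) at_top"
proof (rule decreasing_tendsto)
  show "\<forall>\<^sub>F x in at_top. (INF x\<in>{a<..}. h x) \<le> h x"
    using eventually_gt_at_top[of a] by eventually_elim (auto intro: INF_lower)
next
  fix y assume "(INF x\<in>{a<..}. h x) < y"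
  then obtain c where c: "c > a" "h c < y"
    by (auto simp: INF_less_iff)
  show "\<forall>\<^sub>F x in at_top. h x < y"
    using eventually_gt_at_top[of c]
    by eventually_elim (use c assms in \<open>auto simp: monotone_on_def intro: le_less_trans[of _ "h c"]\<close>)
qed

lemma order_filter_neq_bot: "order_filter p \<noteq> bot"
  by (simp add: order_filter_def)

text \<open>\<open>Lim\<close> is unspecified without convergence. In a complete linear order,
  antimonotonicity on each side of 1 supplies the limit.\<close>

lemma tendsto_order_filter_limit_extension:
  fixes h :: "real \<Rightarrow> 'a::{complete_linorder, linorder_topology}"
  assumes "antimono_on {0<..<1} h" "antimono_on {1<..} h" "p \<in> {0, 1, top}"
  shows "(h \<longlongrightarrow> limit_extension h p) (order_filter p)"
proof -
  have "antimono_on {1<..<2} h"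
    using assms(2) by (auto simp: monotone_on_def)
  then have "\<exists>l. (h \<longlongrightarrow> l) (order_filter p)"
    using antimono_on_tendsto_at_right_SUP[OF assms(1)] antimono_on_tendsto_at_top_INF[OF assms(2)]
      antimono_on_tendsto_at_right_SUP[of 1 2 h] assms(3)
    by (auto simp: order_filter_def)
  then show ?thesis
    using assms(3) tendsto_Lim[OF order_filter_neq_bot] by (fastforce simp: limit_extension_def)
qed

text \<open>Positive orders suffice even for \<open>p = 0\<close>: the filter
  \<open>at_right 0\<close> ignores 0 itself, where the quantifiers would divide by zero.\<close>

lemma limit_extension_cong:
  assumes "\<And>q. 0 < q \<Longrightarrow> f q = g q"
  shows "limit_extension f p = limit_extension g p"
proof (cases "p \<in> {0, 1, top}")
  case True
  have "\<forall>\<^sub>F q in order_filter p. q > 0"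
    using True by (auto simp: order_filter_def eventually_at_right_less eventually_gt_at_top
        intro: eventually_mono[OF eventually_at_right_less])
  then have "\<forall>\<^sub>F q in order_filter p. f q = g q"
    by eventually_elim (use assms in auto)
  then show ?thesis
    using True by (simp add: limit_extension_def Topological_Spaces.Lim_def tendsto_cong)
next
  case False
  then have "0 < enn2real p"
    by (simp add: enn2real_positive_iff top.not_eq_extremum zero_less_iff_neq_zero)
  then show ?thesis
    using False assms by (simp add: limit_extension_def)
qed

section \<open>Power integrals of a density\<close>

locale probability_density =
  fixes M :: "'i measure" and \<phi> :: "'i \<Rightarrow> ennreal"
  assumes measurable_density [measurable]: "\<phi> \<in> borel_measurable M"
    and density_le_1: "\<And>i. i \<in> space M \<Longrightarrow> \<phi> i \<le> 1"
    and nn_integral_density: "(\<integral>\<^sup>+ i. \<phi> i \<partial>M) = 1"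
begin

definition f :: "'i \<Rightarrow> real" where
  "f i = enn2real (\<phi> i)"

definition P :: "real \<Rightarrow> ennreal" where
  "P q = (\<integral>\<^sup>+ i. epow (\<phi> i) q \<partial>M)"

lemma measurable_f [measurable]: "f \<in> borel_measurable M"
  unfolding f_def by measurable

lemma f_nonneg [simp]: "0 \<le> f i"
  by (simp add: f_def)

lemma f_le_1: "i \<in> space M \<Longrightarrow> f i \<le> 1"
  using density_le_1[of i] enn2real_leI[of 1 "\<phi> i"] by (simp add: f_def)

lemma ennreal_f: "i \<in> space M \<Longrightarrow> ennreal (f i) = \<phi> i"
  using density_le_1[of i] by (auto simp: f_def ennreal_enn2real_if top_unique)

lemma nn_integral_f: "(\<integral>\<^sup>+ i. ennreal (f i) \<partial>M) = 1"
  using nn_integral_density by (simp add: ennreal_f cong: nn_integral_cong)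

lemma P_eq: "0 < q \<Longrightarrow> P q = (\<integral>\<^sup>+ i. ennreal (f i powr q) \<partial>M)"
  unfolding P_def by (intro nn_integral_cong) (simp flip: ennreal_f add: epow_ennreal)

text \<open>Otherwise the density would vanish almost everywhere, against its total mass 1.\<close>

lemma P_neq_0:
  assumes "0 < q"
  shows "P q \<noteq> 0"
proof
  assume "P q = 0"
  then have "AE i in M. ennreal (f i powr q) = 0"
    using assms by (simp add: P_eq nn_integral_0_iff_AE)
  then have "AE i in M. ennreal (f i) = 0"
    by eventually_elim auto
  then have "(\<integral>\<^sup>+ i. ennreal (f i) \<partial>M) = 0"
    by (simp add: nn_integral_0_iff_AE)
  then show False
    by (simp add: nn_integral_f)
qed

lemma P_le_1:
  assumes "1 < q"
  shows "P q \<le> 1"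
proof -
  have "P q \<le> (\<integral>\<^sup>+ i. ennreal (f i) \<partial>M)"
    using assms powr_mono'[OF less_imp_le, of 1 q]
    by (auto simp: P_eq f_le_1 intro!: nn_integral_mono ennreal_leI)
  then show ?thesis
    by (simp add: nn_integral_f)
qed

lemma P_gt_1E:
  assumes "1 < q"
  obtains c where "P q = ennreal c" "0 < c" "c \<le> 1"
  using P_le_1[OF assms] P_neq_0[of q] assms
  by (cases "P q") (auto simp: ennreal_le_1 top_unique order.strict_iff_order)

text \<open>Jensen's inequality for the probability measure \<open>\<phi> di\<close> and the functions \<open>\<phi>\<^bsup>r-1\<^esup>\<close>: pointwise
  it is Young's inequality \<open>y\<^bsup>\<theta>\<^esup> \<le> \<theta> y + (1 - \<theta>)\<close> at \<open>y = \<phi>\<^bsup>r-1\<^esup> / P r\<close>.\<close>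

lemma P_le_epow:
  assumes "0 < q" "0 < r" "0 < \<theta>" "\<theta> < 1" "q - 1 = \<theta> * (r - 1)"
  shows "P q \<le> epow (P r) \<theta>"
proof (cases "P r")
  case top
  then show ?thesis
    using assms by (simp add: epow_def)
next
  case (real c)
  then have c: "0 < c"
    using P_neq_0[OF \<open>0 < r\<close>] by (simp add: order.strict_iff_order)
  \<comment> \<open>Young's inequality multiplied by \<open>c powr \<theta> * x\<close>. After
    integration the two terms become \<open>\<theta>\<close> and \<open>1 - \<theta>\<close> times
    \<open>c powr \<theta>\<close>.\<close>
  have pointwise: "x powr q \<le> c powr \<theta> * (\<theta> / c) * x powr r + c powr \<theta> * (1 - \<theta>) * x"
    if "0 \<le> x" for x
  proof (cases "x = 0")
    case False
    define y where "y = x powr (r - 1) / c"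
    have x: "x > 0" and y: "y > 0"
      using False that c by (auto simp: y_def)
    have "c powr \<theta> * y powr \<theta> = x powr (q - 1)"
      using c x assms(5) by (simp add: y_def powr_divide powr_powr mult.commute)
    then have "x powr q = x * (c powr \<theta> * y powr \<theta>)"
      using x by (simp add: powr_diff)
    also have "\<dots> \<le> x * (c powr \<theta> * (\<theta> * y + (1 - \<theta>)))"
      using Youngs_inequality_0[of \<theta> "1 - \<theta>" y 1] assms x y
      by (intro mult_left_mono) auto
    also have "\<dots> = c powr \<theta> * (\<theta> / c) * x powr r + c powr \<theta> * (1 - \<theta>) * x"
      using x c by (simp add: y_def powr_diff field_simps)
    finally show ?thesis .
  qed simp
  have "P q \<le> (\<integral>\<^sup>+ i. ennreal (c powr \<theta> * (\<theta> / c)) * ennreal (f i powr r)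
      + ennreal (c powr \<theta> * (1 - \<theta>)) * ennreal (f i) \<partial>M)"
    unfolding P_eq[OF \<open>0 < q\<close>]
    using c assms pointwise
    by (intro nn_integral_mono) (simp flip: ennreal_mult ennreal_plus add: ennreal_leI)
  also have "\<dots> = ennreal (c powr \<theta> * (\<theta> / c)) * ennreal c + ennreal (c powr \<theta> * (1 - \<theta>))"
    using real by (simp add: nn_integral_add nn_integral_cmult nn_integral_f flip: P_eq[OF \<open>0 < r\<close>])
  also have "\<dots> = ennreal (c powr \<theta> * (\<theta> / c) * c + c powr \<theta> * (1 - \<theta>))"
    using c assms by (simp flip: ennreal_mult ennreal_plus)
  also have "c powr \<theta> * (\<theta> / c) * c + c powr \<theta> * (1 - \<theta>) = c powr \<theta>"
    using c by (simp add: field_simps)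
  finally show ?thesis
    using real c assms by (simp add: epow_ennreal)
qed

section \<open>Monotonicity of the Renyi entropy in the order\<close>

lemma renyi_expr_eq: "renyi_expr M \<phi> q = ereal (1 / (1 - q)) * elog (P q)"
  by (simp add: renyi_expr_def P_def)

text \<open>Convexity of \<open>log P\<close> on the segment between 1 and \<open>r\<close>; the
  endpoint 1 contributes \<open>log 1 = 0\<close>.\<close>

lemma elog_P_le:
  assumes "0 < q" "0 < r" "0 < \<theta>" "\<theta> < 1" "q - 1 = \<theta> * (r - 1)"
  shows "elog (P q) \<le> ereal \<theta> * elog (P r)"
  using P_le_epow[OF assms] by (simp add: elog_le_iff flip: elog_epow)

lemma antimono_renyi_expr_lt_1: "antimono_on {0<..<1} (renyi_expr M \<phi>)"
proof (rule monotone_onI)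
  fix q r :: real
  assume qr: "q \<in> {0<..<1}" "r \<in> {0<..<1}" "q \<le> r"
  show "renyi_expr M \<phi> r \<le> renyi_expr M \<phi> q"
  proof (cases "q = r")
    case False
    \<comment> \<open>The interpolated order is the one nearer to 1, here \<open>r\<close>, so that
      \<open>r - 1 = \<theta> * (q - 1)\<close>.\<close>
    define \<theta> where "\<theta> = (1 - r) / (1 - q)"
    have "elog (P r) \<le> ereal \<theta> * elog (P q)"
      using qr False by (intro elog_P_le) (auto simp: \<theta>_def field_simps)
    then have "ereal (1 / (1 - r)) * elog (P r) \<le> ereal (1 / (1 - r)) * (ereal \<theta> * elog (P q))"
      using qr by (intro ereal_mult_left_mono) auto
    also have "\<dots> = ereal (1 / (1 - q)) * elog (P q)"
      using qr by (simp add: \<theta>_def flip: mult.assoc)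
    finally show ?thesis
      by (simp add: renyi_expr_eq)
  qed simp
qed

lemma antimono_renyi_expr_gt_1: "antimono_on {1<..} (renyi_expr M \<phi>)"
proof (rule monotone_onI)
  fix q r :: real
  assume qr: "q \<in> {1<..}" "r \<in> {1<..}" "q \<le> r"
  show "renyi_expr M \<phi> r \<le> renyi_expr M \<phi> q"
  proof (cases "q = r")
    case False
    define \<theta> where "\<theta> = (q - 1) / (r - 1)"
    have "elog (P q) \<le> ereal \<theta> * elog (P r)"
      using qr False by (intro elog_P_le) (auto simp: \<theta>_def field_simps)
    then have "ereal (1 / (q - 1)) * elog (P q) \<le> ereal (1 / (q - 1)) * (ereal \<theta> * elog (P r))"
      using qr by (intro ereal_mult_left_mono) auto
    also have "\<dots> = ereal (1 / (r - 1)) * elog (P r)"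
      using qr by (simp add: \<theta>_def flip: mult.assoc)
    \<comment> \<open>Above order 1 the factor \<open>1 / (1 - q)\<close> is negative, so the
      estimate uses its positive opposite and is then negated.\<close>
    finally have *: "- (ereal (1 / (r - 1)) * elog (P r)) \<le> - (ereal (1 / (q - 1)) * elog (P q))"
      by (simp only: ereal_minus_le_minus)
    have "1 / (1 - x) = - (1 / (x - 1))" for x :: real
      by (metis minus_diff_eq minus_divide_right)
    then have "renyi_expr M \<phi> x = - (ereal (1 / (x - 1)) * elog (P x))" for x
      by (metis renyi_expr_eq ereal_mult_minus_left uminus_ereal.simps(1))
    with * show ?thesis
      by simp
  qed simp
qed

section \<open>Convergence at the extreme orders and the semantic formulas\<close>

lemma antimono_on_eexp:
  "antimono_on A h \<Longrightarrow> antimono_on A (\<lambda>q. eexp (h q))"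
  by (auto simp: monotone_on_def intro: eexp_mono)

lemma hill_number_eq: "hill_number M \<phi> = limit_extension (\<lambda>q. eexp (renyi_expr M \<phi> q))"
  by (simp add: hill_number_def renyi_expr_def eexp_scale_elog)

lemma tendsto_renyi_entropy:
  "p \<in> {0, 1, top} \<Longrightarrow> (renyi_expr M \<phi> \<longlongrightarrow> renyi_entropy M \<phi> p) (order_filter p)"
  unfolding renyi_entropy_def
  by (intro tendsto_order_filter_limit_extension antimono_renyi_expr_lt_1 antimono_renyi_expr_gt_1)

lemma tendsto_hill_number:
  "p \<in> {0, 1, top} \<Longrightarrow>
    ((\<lambda>q. eexp (renyi_expr M \<phi> q)) \<longlongrightarrow> hill_number M \<phi> p) (order_filter p)"
  unfolding hill_number_eq
  by (intro tendsto_order_filter_limit_extension antimono_on_eexp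
      antimono_renyi_expr_lt_1 antimono_renyi_expr_gt_1)

lemma renyi_entropy_eq_additive_entropy: "renyi_entropy M \<phi> p = additive_entropy M \<phi> p"
  unfolding renyi_entropy_def additive_entropy_def
proof (rule limit_extension_cong)
  fix q :: real assume "0 < q"
  then show "renyi_expr M \<phi> q
      = add_scale (q / (1 - q)) (add_forall M q (\<lambda>i. add_neg (- elog (\<phi> i))))"
    by (simp add: renyi_expr_def add_scale_def add_forall_def add_neg_def eexp_scale_elog
        flip: mult.assoc)
qed

text \<open>The inner exponents give \<open>(-1) * (-q) = q\<close>, the outer ones
  \<open>(-1 / q) * (q / (1 - q)) = - 1 / (1 - q)\<close>; the outer \<open>mul_neg\<close> removes
  the remaining sign.\<close>

lemma mul_neg_multiplicative_diversity:
  "mul_neg (multiplicative_diversity M \<phi> p) = hill_number M \<phi> p"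
proof -
  let ?h = "\<lambda>q. eexp (renyi_expr M \<phi> q)"
  have "multiplicative_diversity M \<phi> p = limit_extension (\<lambda>q. mul_neg (?h q)) p"
    unfolding multiplicative_diversity_def
  proof (rule limit_extension_cong)
    fix q :: real assume "0 < q"
    then show "mul_scale (q / (1 - q)) (mul_forall M q (\<lambda>i. mul_neg (\<phi> i))) = mul_neg (?h q)"
      by (simp add: renyi_expr_def mul_scale_def mul_forall_def mul_neg_eq_epow epow_epow
          eexp_scale_elog)
  qed
  also have "\<dots> = mul_neg (hill_number M \<phi> p)"
  proof (cases "p \<in> {0, 1, top}")
    \<comment> \<open>Negation is continuous, so it commutes with the limit that
      \<open>tendsto_hill_number\<close> provides.\<close>
    case True
    then show ?thesis
      using tendsto_Lim[OF order_filter_neq_bot tendsto_mul_neg[OF tendsto_hill_number[OF True]]]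
      by (simp add: limit_extension_def)
  next
    case False
    then show ?thesis
      by (simp add: limit_extension_def hill_number_eq)
  qed
  finally show ?thesis
    by (simp add: mul_neg_def)
qed

section \<open>Order 1 and the Shannon entropy\<close>

lemma shannon_entropy_eq:
  "shannon_entropy M \<phi> = enn2ereal (\<integral>\<^sup>+ i. ennreal (- f i * ln (f i)) \<partial>M)"
proof -
  have "\<phi> i * e2ennreal (- elog (\<phi> i)) = ennreal (- f i * ln (f i))" if "i \<in> space M" for i
  proof (cases "f i = 0")
    case True
    then show ?thesis
      using ennreal_f[OF that] by auto
  next
    case False
    then have "0 < f i"
      by (simp add: order.strict_iff_order)
    then show ?thesis
      using ennreal_f[OF that] f_le_1[OF that]
      by (simp flip: ennreal_f[OF that] ennreal_mult add: elog_ennreal e2ennreal_ereal)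
  qed
  then show ?thesis
    unfolding shannon_entropy_def by (metis (no_types, lifting) nn_integral_cong)
qed

text \<open>Jensen's inequality for \<open>exp\<close>, from its tangent at \<open>(1 - q) s\<close>.\<close>

lemma renyi_expr_le_shannon:
  assumes "1 < q"
  shows "renyi_expr M \<phi> q \<le> shannon_entropy M \<phi>"
proof (cases "\<integral>\<^sup>+ i. ennreal (- f i * ln (f i)) \<partial>M")
  case top
  then show ?thesis
    by (simp add: shannon_entropy_eq)
next
  case (real s)
  define t where "t = q - 1"
  define e where "e = exp (- t * s)"
  have t: "0 < t" and e: "0 < e"
    using assms by (auto simp: t_def e_def)
  obtain c where c: "P q = ennreal c" "0 < c" "c \<le> 1"
    using P_gt_1E[OF assms] .
  have pointwise: "e * (1 + t * s) * x \<le> x powr q + e * t * (- x * ln x)" if "0 \<le> x" for x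
  proof (cases "x = 0")
    case False
    \<comment> \<open>The tangent of \<open>exp\<close> at \<open>- t * s\<close>, divided by its
      value \<open>e\<close> there.\<close>
    have "1 + (t * s + t * ln x) \<le> exp (t * s + t * ln x)"
      by (rule exp_ge_add_one_self)
    then have "e * (1 + (t * s + t * ln x)) \<le> e * exp (t * s + t * ln x)"
      using e by (intro mult_left_mono) auto
    also have "\<dots> = x powr t"
      using False that by (simp add: e_def powr_def flip: exp_add)
    finally have "x * (e * (1 + (t * s + t * ln x))) \<le> x * x powr t"
      using that by (rule mult_left_mono)
    then show ?thesis
      using False that by (simp add: t_def powr_diff algebra_simps)
  qed simp
  have "ennreal (e * (1 + t * s)) = (\<integral>\<^sup>+ i. ennreal (e * (1 + t * s)) * ennreal (f i) \<partial>M)"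
    by (simp add: nn_integral_cmult nn_integral_f)
  also have "\<dots> \<le> (\<integral>\<^sup>+ i. ennreal (f i powr q) + ennreal (e * t) * ennreal (- f i * ln (f i)) \<partial>M)"
  proof (rule nn_integral_mono)
    fix i assume "i \<in> space M"
    define z where "z = - f i * ln (f i)"
    have "0 \<le> z"
      using f_le_1[OF \<open>i \<in> space M\<close>] f_nonneg[of i]
      by (cases "f i = 0") (auto simp: z_def mult_nonneg_nonpos order.strict_iff_order)
    moreover have "e * (1 + t * s) * f i \<le> f i powr q + e * t * z"
      using pointwise[OF f_nonneg, of i] by (simp add: z_def)
    ultimately have "ennreal (e * (1 + t * s)) * ennreal (f i)
        \<le> ennreal (f i powr q) + ennreal (e * t) * ennreal z"
      using e t real by (simp flip: ennreal_mult ennreal_plus add: ennreal_leI)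
    then show "ennreal (e * (1 + t * s)) * ennreal (f i)
        \<le> ennreal (f i powr q) + ennreal (e * t) * ennreal (- f i * ln (f i))"
      unfolding z_def .
  qed
  also have "\<dots> = ennreal c + ennreal (e * t) * ennreal s"
    using assms c real by (subst nn_integral_add) (auto simp: nn_integral_cmult P_eq)
  also have "\<dots> = ennreal (c + e * t * s)"
    using c e t real by (simp flip: ennreal_mult ennreal_plus)
  \<comment> \<open>The integrals give \<open>e * (1 + t * s) <= c + e * t * s\<close>, and the
    finite term \<open>e * t * s\<close> cancels.\<close>
  finally have "e \<le> c"
    using c e t real by (simp add: algebra_simps)
  then have "- t * s \<le> ln c"
    using c e by (simp add: e_def ln_ge_iff)
  then have "1 / (1 - q) * ln c \<le> s"
    using t by (simp add: t_def field_simps)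
  then show ?thesis
    using c real by (simp add: renyi_expr_eq elog_ennreal shannon_entropy_eq)
qed

lemma nn_integral_difference_quotient_le_renyi_expr:
  assumes "1 < q"
  shows "enn2ereal (\<integral>\<^sup>+ i. ennreal ((f i - f i powr q) / (q - 1)) \<partial>M) \<le> renyi_expr M \<phi> q"
proof -
  obtain c where c: "P q = ennreal c" "0 < c" "c \<le> 1"
    using P_gt_1E[OF assms] .
  \<comment> \<open>Keeps the differences nonnegative, so that truncation in \<open>ennreal\<close>
    changes nothing.\<close>
  have powr_le: "f i powr q \<le> f i" if "i \<in> space M" for i
    using powr_mono'[of 1 q "f i"] f_le_1[OF that] assms by simp
  have "(\<integral>\<^sup>+ i. ennreal ((f i - f i powr q) / (q - 1)) \<partial>M)
      = (\<integral>\<^sup>+ i. ennreal (1 / (q - 1)) * (ennreal (f i) - ennreal (f i powr q)) \<partial>M)"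
    using assms powr_le
    by (intro nn_integral_cong) (simp add: ennreal_minus flip: ennreal_mult)
  also have "\<dots> = ennreal (1 / (q - 1)) * (1 - P q)"
    using assms c powr_le
    by (simp add: nn_integral_cmult)
       (subst nn_integral_diff, auto simp: nn_integral_f ennreal_leI P_eq intro!: AE_I2)
  also have "\<dots> = ennreal ((1 - c) / (q - 1))"
    using c assms by (simp add: ennreal_minus flip: ennreal_mult ennreal_1)
  also have "enn2ereal \<dots> = ereal ((1 - c) / (q - 1))"
    using c assms by simp
  also have "(1 - c) / (q - 1) \<le> 1 / (1 - q) * ln c"
  proof -
    have "1 / (1 - q) * ln c = - ln c / (q - 1)"
      using assms by (simp add: divide_simps) (simp add: algebra_simps)
    moreover have "(1 - c) / (q - 1) \<le> - ln c / (q - 1)"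
      using ln_le_minus_one[of c] c assms by (intro divide_right_mono) auto
    ultimately show ?thesis
      by simp
  qed
  finally show ?thesis
    using c by (simp add: renyi_expr_eq elog_ennreal)
qed

lemma renyi_entropy_1: "renyi_entropy M \<phi> 1 = shannon_entropy M \<phi>"
proof (rule antisym)
  have lim: "(renyi_expr M \<phi> \<longlongrightarrow> renyi_entropy M \<phi> 1) (at_right 1)"
    using tendsto_renyi_entropy[of 1] by (simp add: order_filter_def)
  show "renyi_entropy M \<phi> 1 \<le> shannon_entropy M \<phi>"
    using lim by (rule tendsto_upperbound)
      (auto intro: eventually_mono[OF eventually_at_right_less] renyi_expr_le_shannon)
  \<comment> \<open>By antimonotonicity the right limit at 1 dominates every value at a larger
    order.\<close>
  have upper: "renyi_expr M \<phi> q \<le> renyi_entropy M \<phi> 1" if "1 < q" for q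
    using lim
  proof (rule tendsto_lowerbound)
    show "\<forall>\<^sub>F r in at_right 1. renyi_expr M \<phi> q \<le> renyi_expr M \<phi> r"
      using eventually_at_right_real[OF that]
      by eventually_elim (use antimono_renyi_expr_gt_1 in \<open>auto simp: monotone_on_def\<close>)
  qed simp
  \<comment> \<open>Fatou's lemma is applied along a sequence of orders decreasing to 1.\<close>
  define q where "q n = 1 + 1 / (real n + 1)" for n
  define u where "u n i = ennreal ((f i - f i powr q n) / (q n - 1))" for n i
  have q: "1 < q n" for n
    by (simp add: q_def)
  have bound: "(\<integral>\<^sup>+ i. u n i \<partial>M) \<le> e2ennreal (renyi_entropy M \<phi> 1)" for n
    using e2ennreal_mono[OF order.trans[OF
          nn_integral_difference_quotient_le_renyi_expr[OF q] upper[OF q]]]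
    by (simp add: u_def)
  \<comment> \<open>The limit is minus the derivative of \<open>r \<mapsto> f i powr r\<close> at 1;
    where \<open>f i = 0\<close>, everything is 0.\<close>
  have u_lim: "(\<lambda>n. u n i) \<longlonglongrightarrow> ennreal (- f i * ln (f i))" for i
  proof (cases "f i = 0")
    case False
    then have "0 < f i"
      by (simp add: order.strict_iff_order)
    then have "((\<lambda>r. f i powr r) has_real_derivative f i powr 1 * ln (f i)) (at 1)"
      by (auto intro!: derivative_eq_intros)
    then have "((\<lambda>r. (f i powr r - f i) / (r - 1)) \<longlongrightarrow> f i * ln (f i)) (at 1)"
      using \<open>0 < f i\<close> by (simp add: has_field_derivative_iff LIM_offset_zero_iff)
    then have "((\<lambda>r. (f i - f i powr r) / (r - 1)) \<longlongrightarrow> - f i * ln (f i)) (at 1)"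
      using tendsto_minus by (fastforce simp: minus_divide_left)
    moreover have "filterlim q (at 1) sequentially"
      unfolding q_def by real_asymp
    ultimately have "(\<lambda>n. (f i - f i powr q n) / (q n - 1)) \<longlonglongrightarrow> - f i * ln (f i)"
      by (rule filterlim_compose)
    then show ?thesis
      unfolding u_def by (rule tendsto_ennrealI)
  qed (simp add: u_def)
  have "(\<integral>\<^sup>+ i. ennreal (- f i * ln (f i)) \<partial>M) = (\<integral>\<^sup>+ i. liminf (\<lambda>n. u n i) \<partial>M)"
    using lim_imp_Liminf[OF _ u_lim] by simp
  also have "\<dots> \<le> liminf (\<lambda>n. \<integral>\<^sup>+ i. u n i \<partial>M)"
    by (rule nn_integral_liminf) (simp add: u_def)
  also have "\<dots> \<le> e2ennreal (renyi_entropy M \<phi> 1)"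
    using Liminf_mono[of "\<lambda>n. \<integral>\<^sup>+ i. u n i \<partial>M" "\<lambda>_. e2ennreal (renyi_entropy M \<phi> 1)" sequentially] bound
    by (simp add: Liminf_const)
  finally have "shannon_entropy M \<phi> \<le> enn2ereal (e2ennreal (renyi_entropy M \<phi> 1))"
    by (simp add: shannon_entropy_eq less_eq_ennreal.rep_eq)
  \<comment> \<open>\<open>e2ennreal\<close> sends negative values to 0, so undoing it requires
    nonnegativity; any order above 1 would serve in place of 2.\<close>
  moreover have "0 \<le> renyi_entropy M \<phi> 1"
    using order.trans[OF order.trans[OF enn2ereal_nonneg
          nn_integral_difference_quotient_le_renyi_expr] upper, of 2] by simp
  ultimately show "shannon_entropy M \<phi> \<le> renyi_entropy M \<phi> 1"
    by (simp add: enn2ereal_e2ennreal)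
qed

end

theorem mainTheorem2:
  fixes M :: "'i measure" and \<phi> :: "'i \<Rightarrow> ennreal" and p :: ennreal
  assumes "\<phi> \<in> borel_measurable M"
    and "\<And>i. i \<in> space M \<Longrightarrow> \<phi> i \<le> 1"
    and "(\<integral>\<^sup>+ i. \<phi> i \<partial>M) = 1"
  shows "(p \<in> {0, 1, top} \<longrightarrow> (renyi_expr M \<phi> \<longlongrightarrow> renyi_entropy M \<phi> p) (order_filter p))
    \<and> renyi_entropy M \<phi> 1 = shannon_entropy M \<phi>
    \<and> renyi_entropy M \<phi> p = additive_entropy M \<phi> p
    \<and> mul_neg (multiplicative_diversity M \<phi> p) = hill_number M \<phi> p"
proof -
  interpret probability_density M \<phi>
    using assms by unfold_locales
  show ?thesis
    using tendsto_renyi_entropy renyi_entropy_1 renyi_entropy_eq_additive_entropy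
      mul_neg_multiplicative_diversity by blast
qed

end
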